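(* Let $s>0$. For $\delta>0$ and $\lambda>0$ consider the real quadratic form in $(X,Y)\in\mathbb R^2$ $$\widetilde{\mathcal Q}(X,Y):=\Big(1-\frac{\delta s^2}{1+s^2}-\frac\lambda2\Big(1+\frac{\delta s}{1+s^2}\Big)\Big)X^2-\frac{\delta s}{1+s^2}\big(1+\sqrt3\,s\big)XY+\Big(\frac{\delta s^2}{1+s^2}-\frac\lambda2\Big(1+\frac{\delta s}{1+s^2}\Big)\Big)Y^2 .$$ The largest value of $\lambda>0$ for which there is some $\delta>0$ such that $\widetilde{\mathcal Q}$ is nonnegative (on $\mathbb R^2$) is $$\tilde\lambda_2(s):=\frac{7s^2+2(1+\sqrt3)s+1-\sqrt{21s^4+4(3+5\sqrt3)s^3+(22+8\sqrt3)s^2+4(1+\sqrt3)s+1}}{7s^2+2(2+\sqrt3)s+2},$$ with corresponding $\delta$ given by $$\tilde\delta_2(s):=\frac{s^2+1}{s}\,\frac{\tilde\lambda_2(s)^2-\tilde\lambda_2(s)+2s}{7s^2+2\sqrt3\,s+1-\tilde\lambda_2(s)^2}.$$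
   Context: The form corresponds to the parameter choice $\lambda_m=1$, $\lambda_M=s^2$, $C_M=\frac{s(1+\sqrt3 s)}{1+s^2}$ (with $s=|\xi|$ the modulus of a Fourier variable); these values have already been substituted in the definition of $\widetilde{\mathcal Q}$. *)

theory Defs
  imports Complex_Main
begin

definition Qtilde :: "real \<Rightarrow> real \<Rightarrow> real \<Rightarrow> real \<Rightarrow> real \<Rightarrow> real" where
  "Qtilde s \<delta> l X Y =
     (1 - \<delta> * s^2 / (1 + s^2) - l / 2 * (1 + \<delta> * s / (1 + s^2))) * X^2
     - \<delta> * s / (1 + s^2) * (1 + sqrt 3 * s) * X * Y
     + (\<delta> * s^2 / (1 + s^2) - l / 2 * (1 + \<delta> * s / (1 + s^2))) * Y^2"

definition Qtilde_nonneg :: "real \<Rightarrow> real \<Rightarrow> real \<Rightarrow> bool" where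
  "Qtilde_nonneg s \<delta> l \<longleftrightarrow> (\<forall>X Y. Qtilde s \<delta> l X Y \<ge> 0)"

definition lambda2 :: "real \<Rightarrow> real" where
  "lambda2 s =
     (7 * s^2 + 2 * (1 + sqrt 3) * s + 1
       - sqrt (21 * s^4 + 4 * (3 + 5 * sqrt 3) * s^3 + (22 + 8 * sqrt 3) * s^2
               + 4 * (1 + sqrt 3) * s + 1))
     / (7 * s^2 + 2 * (2 + sqrt 3) * s + 2)"

definition delta2 :: "real \<Rightarrow> real" where
  "delta2 s =
     (s^2 + 1) / s
     * (((lambda2 s)^2 - lambda2 s + 2 * s) / (7 * s^2 + 2 * sqrt 3 * s + 1 - (lambda2 s)^2))"

end

theory Submission
  imports Defs
begin

text \<open>
  Put \<open>k = 1 + \<surd>3 s\<close> and rescale \<open>\<delta>\<close> to \<open>a = \<delta> s / (1 + s\<^sup>2)\<close>. A binary quadratic form is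
  nonnegative exactly when its trace is nonnegative and its discriminant is nonpositive. Here these
  conditions read \<open>l (1 + a) \<le> 1\<close> and \<open>(1 - 2 a s)\<^sup>2 + (a k)\<^sup>2 \<le> (1 - l (1 + a))\<^sup>2\<close>; call the pair
  \<open>(a, l)\<close> admissible when both hold.

  For fixed \<open>l\<close> the second condition is a quadratic inequality in \<open>a\<close>, with leading coefficient
  \<open>4 s\<^sup>2 + k\<^sup>2 - l\<^sup>2 > 0\<close>, so it has a solution only if the discriminant in \<open>a\<close> is nonnegative.
  In that discriminant the terms of degree three and four in \<open>l\<close> cancel, which leaves a quadratic
  polynomial \<open>D(l)\<close> with two distinct real roots; \<open>lambda2\<close> is the smaller one. At a root of \<open>D\<close>
  the quadratic inequality in \<open>a\<close> has only its vertex as solution, and this vertex is the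
  rescaled \<open>delta2\<close>.

  The condition \<open>D(l) \<ge> 0\<close> alone would also allow \<open>l\<close> beyond the larger root. This is excluded by
  monotonicity: if \<open>(a, l)\<close> is admissible, so is \<open>(a, l')\<close> for every smaller \<open>l' \<ge> 0\<close>, and
  hence \<open>D\<close> is nonnegative on all of \<open>(0, l]\<close>; but \<open>D\<close> is negative midway between its roots.
\<close>

text \<open>
  The discriminant bound is read off at the vector \<open>(-B, 2A)\<close>, where the form takes the value
  \<open>A (4AC - B\<^sup>2)\<close>; this vector is useless only when \<open>A = 0\<close>.
\<close>

lemma binary_form_nonneg_iff:
  fixes A B C :: real
  shows "(\<forall>X Y. A * X^2 + B * X * Y + C * Y^2 \<ge> 0) \<longleftrightarrow> A + C \<ge> 0 \<and> B^2 \<le> 4 * A * C"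
proof
  assume form: "\<forall>X Y. A * X^2 + B * X * Y + C * Y^2 \<ge> 0"
  have A: "A \<ge> 0" using form[rule_format, of 1 0] by simp
  have C: "C \<ge> 0" using form[rule_format, of 0 1] by simp
  have "B^2 \<le> 4 * A * C"
  proof (cases "A = 0")
    case True
    have "- (B^2) \<ge> 0"
      using form[rule_format, of "- (C + 1)" B] True
      by (simp add: algebra_simps power2_eq_square)
    with True show ?thesis by simp
  next
    case False
    have "A * (4 * A * C - B^2) \<ge> 0"
      using form[rule_format, of "- B" "2 * A"] by (simp add: algebra_simps power2_eq_square)
    with A False show ?thesis by (simp add: zero_le_mult_iff)
  qed
  with A C show "A + C \<ge> 0 \<and> B^2 \<le> 4 * A * C" by simp
next
  assume AC: "A + C \<ge> 0 \<and> B^2 \<le> 4 * A * C"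
  then have "A * C \<ge> 0" using zero_le_power2[of B] by linarith
  with AC have A: "A \<ge> 0" and C: "C \<ge> 0" by (auto simp: zero_le_mult_iff)
  show "\<forall>X Y. A * X^2 + B * X * Y + C * Y^2 \<ge> 0"
  proof (intro allI)
    fix X Y :: real
    show "A * X^2 + B * X * Y + C * Y^2 \<ge> 0"
    proof (cases "A = 0")
      case True
      with AC have "B = 0" by simp
      with True C show ?thesis by simp
    next
      case False
      have "4 * A * (A * X^2 + B * X * Y + C * Y^2)
          = (2 * A * X + B * Y)^2 + (4 * A * C - B^2) * Y^2"
        by (simp add: algebra_simps power2_eq_square)
      also have "\<dots> \<ge> 0" using AC by simp
      finally show ?thesis using A False by (simp add: zero_le_mult_iff)
    qed
  qed
qed

definition admissible :: "real \<Rightarrow> real \<Rightarrow> real \<Rightarrow> real \<Rightarrow> bool" where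
  "admissible s k a l \<longleftrightarrow>
     l * (1 + a) \<le> 1 \<and> (1 - 2 * a * s)^2 + (a * k)^2 \<le> (1 - l * (1 + a))^2"

lemma Qtilde_nonneg_iff_admissible:
  "Qtilde_nonneg s \<delta> l \<longleftrightarrow> admissible s (1 + sqrt 3 * s) (\<delta> * s / (1 + s^2)) l"
proof -
  define a where "a = \<delta> * s / (1 + s^2)"
  define k where "k = 1 + sqrt 3 * s"
  define A where "A = 1 - a * s - l / 2 * (1 + a)"
  define C where "C = a * s - l / 2 * (1 + a)"
  have as: "\<delta> * s^2 / (1 + s^2) = a * s" by (simp add: a_def power2_eq_square)
  have "Qtilde s \<delta> l X Y = A * X^2 + (- (a * k)) * X * Y + C * Y^2" for X Y
    unfolding Qtilde_def as A_def C_def k_def by (simp add: a_def[symmetric])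
  then have "Qtilde_nonneg s \<delta> l \<longleftrightarrow> A + C \<ge> 0 \<and> (a * k)^2 \<le> 4 * A * C"
    unfolding Qtilde_nonneg_def using binary_form_nonneg_iff[of A "- (a * k)" C] by simp
  moreover have "4 * A * C = (1 - l * (1 + a))^2 - (1 - 2 * a * s)^2"
    by (simp add: A_def C_def field_simps power2_eq_square)
  moreover have "A + C = 1 - l * (1 + a)" by (simp add: A_def C_def)
  ultimately show ?thesis
    by (auto simp: admissible_def a_def[symmetric] k_def[symmetric])
qed

lemma admissible_antimono:
  assumes "admissible s k a l" "l' \<le> l" "a \<ge> 0"
  shows "admissible s k a l'"
proof -
  have le: "l' * (1 + a) \<le> l * (1 + a)" using assms by (intro mult_right_mono) auto
  have l: "l * (1 + a) \<le> 1" using assms(1) by (simp add: admissible_def)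
  have "(1 - l * (1 + a))^2 \<le> (1 - l' * (1 + a))^2" using l le by (intro power_mono) auto
  with assms(1) have "(1 - 2 * a * s)^2 + (a * k)^2 \<le> (1 - l' * (1 + a))^2"
    unfolding admissible_def by linarith
  with l le show ?thesis by (simp add: admissible_def)
qed

lemma admissible_less_one:
  assumes "admissible s k a l" "l > 0" "a > 0"
  shows "l < 1"
proof -
  have "l + l * a \<le> 1" using assms(1) by (simp add: admissible_def algebra_simps)
  moreover have "l * a > 0" using assms by simp
  ultimately show ?thesis by linarith
qed

text \<open>A quarter of the discriminant in \<open>a\<close> of the quadratic condition for admissibility.\<close>

definition discr :: "real \<Rightarrow> real \<Rightarrow> real \<Rightarrow> real" where
  "discr s k l = (2 * s - l + l^2)^2 - (4 * s^2 + k^2 - l^2) * (2 * l - l^2)"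

text \<open>
  The cancellation of the higher powers of \<open>l\<close>, after completing the square in \<open>l\<close>. For \<open>s > 0\<close>
  and \<open>k \<noteq> 0\<close> the subtracted term is positive, so the roots are real and distinct.
\<close>

lemma discr_complete_square:
  "(4 * s^2 + k^2 + 4 * s + 1) * discr s k l
   = ((4 * s^2 + k^2 + 4 * s + 1) * l - (4 * s^2 + k^2 + 2 * s))^2 - k^2 * (4 * s^2 + k^2 + 4 * s)"
  unfolding discr_def by algebra

text \<open>Completing the square in \<open>a\<close>.\<close>

lemma admissible_iff_vertex:
  assumes "4 * s^2 + k^2 - l^2 > 0"
  shows "admissible s k a l \<longleftrightarrow>
    l * (1 + a) \<le> 1 \<and> ((4 * s^2 + k^2 - l^2) * a - (2 * s - l + l^2))^2 \<le> discr s k l"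
proof -
  have "(4 * s^2 + k^2 - l^2) * ((1 - 2 * a * s)^2 + (a * k)^2 - (1 - l * (1 + a))^2)
      = ((4 * s^2 + k^2 - l^2) * a - (2 * s - l + l^2))^2 - discr s k l"
    unfolding discr_def by algebra
  moreover have "(1 - 2 * a * s)^2 + (a * k)^2 \<le> (1 - l * (1 + a))^2 \<longleftrightarrow>
      (4 * s^2 + k^2 - l^2) * ((1 - 2 * a * s)^2 + (a * k)^2 - (1 - l * (1 + a))^2) \<le> 0"
    using assms by (auto simp: mult_le_0_iff)
  ultimately have "(1 - 2 * a * s)^2 + (a * k)^2 \<le> (1 - l * (1 + a))^2 \<longleftrightarrow>
      ((4 * s^2 + k^2 - l^2) * a - (2 * s - l + l^2))^2 \<le> discr s k l"
    by linarith
  then show ?thesis by (simp add: admissible_def)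
qed

lemma leading_coeff_pos:
  fixes s k l :: real
  assumes "k \<ge> 1" "s > 0" "0 \<le> l" "l < 1"
  shows "4 * s^2 + k^2 - l^2 > 0"
proof -
  have "l^2 < 1" using assms by (simp add: power_less_one_iff)
  moreover have "k^2 \<ge> 1" using assms by simp
  moreover have "s^2 > 0" using assms by simp
  ultimately show ?thesis by linarith
qed

definition smaller_root :: "real \<Rightarrow> real \<Rightarrow> real" where
  "smaller_root s k =
     (4 * s^2 + k^2 + 2 * s - k * sqrt (4 * s^2 + k^2 + 4 * s)) / (4 * s^2 + k^2 + 4 * s + 1)"

lemma discr_smaller_root:
  assumes "s > 0"
  shows "discr s k (smaller_root s k) = 0"
proof -
  define L where "L = 4 * s^2 + k^2 + 4 * s + 1"
  have L: "L > 0" using assms by (simp add: L_def add_nonneg_pos)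
  have "L * smaller_root s k - (4 * s^2 + k^2 + 2 * s) = - (k * sqrt (4 * s^2 + k^2 + 4 * s))"
    using L by (simp add: smaller_root_def L_def[symmetric])
  moreover have "(sqrt (4 * s^2 + k^2 + 4 * s))^2 = 4 * s^2 + k^2 + 4 * s"
    using assms by (intro real_sqrt_pow2) simp
  ultimately have "L * discr s k (smaller_root s k) = 0"
    unfolding L_def discr_complete_square by (simp add: power_mult_distrib)
  with L show ?thesis by simp
qed

text \<open>
  The product of the two roots is \<open>4 s\<^sup>2 / (4 s\<^sup>2 + k\<^sup>2 + 4 s + 1)\<close>, so the smaller root equals
  \<open>4 s\<^sup>2\<close> divided by \<open>4 s\<^sup>2 + k\<^sup>2 + 2 s\<close> plus the square root. Dropping the square root gives a
  bound good enough for every sign condition needed at the vertex.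
\<close>

lemma smaller_root_bounds:
  assumes "s > 0" "k \<ge> 1"
  shows "0 < smaller_root s k" "smaller_root s k * (4 * s^2 + k^2 + 2 * s) < 4 * s^2"
proof -
  define M where "M = 4 * s^2 + k^2 + 2 * s"
  define L where "L = 4 * s^2 + k^2 + 4 * s + 1"
  define R where "R = k * sqrt (4 * s^2 + k^2 + 4 * s)"
  define l where "l = smaller_root s k"
  have L: "L > 0" and M: "M > 0" using assms by (simp_all add: L_def M_def add_nonneg_pos)
  have R: "R > 0" using assms by (simp add: R_def add_nonneg_pos)
  have "(sqrt (4 * s^2 + k^2 + 4 * s))^2 = 4 * s^2 + k^2 + 4 * s"
    using assms by (intro real_sqrt_pow2) simp
  then have "R^2 = k^2 * (4 * s^2 + k^2 + 4 * s)" by (simp add: R_def power_mult_distrib)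
  then have "(M - R) * (M + R) = 4 * s^2 * L"
    unfolding M_def L_def by algebra
  moreover have Ll: "L * l = M - R"
    using L unfolding l_def smaller_root_def L_def[symmetric] M_def[symmetric] R_def[symmetric]
    by simp
  ultimately have "L * (l * (M + R)) = L * (4 * s^2)" by (metis mult.assoc mult.commute)
  then have eq: "l * (M + R) = 4 * s^2" using L by simp
  moreover have "4 * s^2 > 0" using assms by simp
  ultimately show pos: "0 < smaller_root s k"
    using M R by (metis add_pos_pos l_def zero_less_mult_pos2)
  show "smaller_root s k * (4 * s^2 + k^2 + 2 * s) < 4 * s^2"
    using eq mult_pos_pos[OF pos R] unfolding l_def[symmetric] M_def[symmetric] distrib_left
    by linarith
qed

lemma smaller_root_less:
  assumes "s > 0" "k \<ge> 1"
  shows "smaller_root s k < 1" "smaller_root s k < 2 * s"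
proof -
  define M where "M = 4 * s^2 + k^2 + 2 * s"
  have lM: "smaller_root s k * M < 4 * s^2" using smaller_root_bounds[OF assms] by (simp add: M_def)
  have M: "M > 0" "4 * s^2 < M * 1" using assms by (simp_all add: M_def add_nonneg_pos)
  have "2 * s < M" using assms by (simp add: M_def add_nonneg_pos)
  then have "2 * s * (2 * s) < M * (2 * s)" using assms by (intro mult_strict_right_mono) auto
  then have "4 * s^2 < M * (2 * s)" by (simp add: power2_eq_square)
  with lM M show "smaller_root s k < 1" "smaller_root s k < 2 * s"
    by (metis less_trans mult.commute mult_less_cancel_left_pos)+
qed

text \<open>
  If \<open>l\<close> lay beyond the midpoint of the two roots, monotonicity would make the midpoint itself
  admissible, although the discriminant is negative there. So \<open>l\<close> lies on the side of the smaller
  root.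
\<close>

lemma admissible_le_smaller_root:
  assumes "s > 0" "k \<ge> 1" "a > 0" "l > 0" "admissible s k a l"
  shows "l \<le> smaller_root s k"
proof -
  define L where "L = 4 * s^2 + k^2 + 4 * s + 1"
  define M where "M = 4 * s^2 + k^2 + 2 * s"
  define T where "T = 4 * s^2 + k^2 + 4 * s"
  have L: "L > 0" and M: "M > 0" and T: "T > 0"
    using assms by (simp_all add: L_def M_def T_def add_nonneg_pos)
  have discr: "L * discr s k x = (L * x - M)^2 - k^2 * T" for x
    unfolding L_def M_def T_def by (rule discr_complete_square)
  have nonneg: "k^2 * T \<le> (L * x - M)^2" if "0 < x" "x \<le> l" for x
  proof -
    have adm: "admissible s k a x" using admissible_antimono assms that by (meson less_imp_le)
    then have "x < 1" using admissible_less_one that assms by blast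
    then have "4 * s^2 + k^2 - x^2 > 0" using leading_coeff_pos assms that by simp
    with adm have "discr s k x \<ge> 0"
      using admissible_iff_vertex zero_le_power2 order_trans by blast
    with L have "L * discr s k x \<ge> 0" by simp
    with discr show ?thesis by simp
  qed
  have "l \<le> M / L"
  proof (rule ccontr)
    assume "\<not> l \<le> M / L"
    with nonneg[of "M / L"] have "k^2 * T \<le> 0" using L M by simp
    moreover have "k^2 * T > 0" using T assms by simp
    ultimately show False by linarith
  qed
  then have "L * l \<le> M" using L by (simp add: field_simps)
  moreover have "(k * sqrt T)^2 \<le> (M - L * l)^2"
    using nonneg[of l] assms T by (simp add: power_mult_distrib power2_commute)
  ultimately have "k * sqrt T \<le> M - L * l" by (intro power2_le_imp_le[of "k * sqrt T"]) simp_all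
  then have "l * L \<le> M - k * sqrt T" by (simp add: mult.commute)
  then show ?thesis
    using L unfolding smaller_root_def L_def[symmetric] M_def[symmetric]
    unfolding T_def[symmetric] by (simp only: pos_le_divide_eq)
qed

definition vertex :: "real \<Rightarrow> real \<Rightarrow> real \<Rightarrow> real" where
  "vertex s k l = (2 * s - l + l^2) / (4 * s^2 + k^2 - l^2)"

lemma vertex_smaller_root_pos:
  assumes "s > 0" "k \<ge> 1"
  shows "vertex s k (smaller_root s k) > 0"
proof -
  define l where "l = smaller_root s k"
  have "0 < l" "l < 1" "l < 2 * s"
    using smaller_root_bounds smaller_root_less assms by (auto simp: l_def)
  with leading_coeff_pos[of k s l] assms show ?thesis
    unfolding vertex_def l_def[symmetric] by (intro divide_pos_pos add_pos_nonneg) auto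
qed

text \<open>
  At the smaller root the discriminant vanishes, so the square completed in \<open>a\<close> must vanish too.
  The trace condition survives at the vertex because there it amounts to
  \<open>l (4 s\<^sup>2 + k\<^sup>2 + 2 s) \<le> 4 s\<^sup>2 + k\<^sup>2\<close>.
\<close>

lemma admissible_smaller_root_iff:
  assumes "s > 0" "k \<ge> 1"
  shows "admissible s k a (smaller_root s k) \<longleftrightarrow> a = vertex s k (smaller_root s k)"
proof -
  define l where "l = smaller_root s k"
  define p where "p = 4 * s^2 + k^2 - l^2"
  have l: "0 < l" "l < 1" using smaller_root_bounds smaller_root_less assms by (auto simp: l_def)
  have p: "p > 0" using leading_coeff_pos l assms by (simp add: p_def)
  have eq: "p * a = 2 * s - l + l^2 \<longleftrightarrow> a = vertex s k l"
    using p unfolding vertex_def p_def[symmetric] by (simp add: eq_divide_eq mult.commute)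
  have "l * (1 + a) \<le> 1" if "p * a = 2 * s - l + l^2"
  proof -
    have "p * (l * (1 + a)) = l * (p + p * a)" by (simp add: algebra_simps)
    also have "\<dots> = l * (4 * s^2 + k^2 + 2 * s) - l^2"
      unfolding that by (simp add: p_def algebra_simps power2_eq_square)
    also have "\<dots> \<le> (4 * s^2 + k^2) - l^2"
    proof (rule diff_right_mono)
      show "l * (4 * s^2 + k^2 + 2 * s) \<le> 4 * s^2 + k^2"
        using smaller_root_bounds(2)[OF assms] unfolding l_def[symmetric]
        by (rule order_trans[OF less_imp_le]) simp
    qed
    finally have "p * (l * (1 + a)) \<le> p * 1" by (simp add: p_def)
    then show ?thesis using p by (simp only: mult_le_cancel_left_pos)
  qed
  moreover have "discr s k l = 0" using discr_smaller_root assms by (simp add: l_def)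
  ultimately have "admissible s k a l \<longleftrightarrow> p * a = 2 * s - l + l^2"
    using admissible_iff_vertex[of s k l a] p by (auto simp: p_def[symmetric])
  with eq show ?thesis by (simp add: l_def)
qed

lemma sum_of_squares_expansion:
  "4 * s^2 + (1 + sqrt 3 * s)^2 = 7 * s^2 + 2 * sqrt 3 * s + (1::real)"
  by (simp add: power2_sum power_mult_distrib)

lemma lambda2_eq_smaller_root:
  assumes "s > 0"
  shows "lambda2 s = smaller_root s (1 + sqrt 3 * s)"
proof -
  define k where "k = 1 + sqrt 3 * s"
  have k: "k > 0" using assms by (simp add: k_def add_pos_pos)
  have k2: "k^2 = 3 * s^2 + 2 * sqrt 3 * s + 1"
    using sum_of_squares_expansion[of s] by (simp add: k_def)
  have "(3 * s^2 + 2 * r * s + 1) * (4 * s^2 + (3 * s^2 + 2 * r * s + 1) + 4 * s)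
      = 21 * s^4 + 4 * (3 + 5 * r) * s^3 + (10 + 4 * r^2 + 8 * r) * s^2 + 4 * (1 + r) * s + 1"
    for r :: real
    by algebra
  from this[of "sqrt 3"]
  have "21 * s^4 + 4 * (3 + 5 * sqrt 3) * s^3 + (22 + 8 * sqrt 3) * s^2 + 4 * (1 + sqrt 3) * s + 1
      = k^2 * (4 * s^2 + k^2 + 4 * s)"
    unfolding k2 by simp
  then have "sqrt (21 * s^4 + 4 * (3 + 5 * sqrt 3) * s^3 + (22 + 8 * sqrt 3) * s^2
      + 4 * (1 + sqrt 3) * s + 1) = k * sqrt (4 * s^2 + k^2 + 4 * s)"
    using k by (simp add: real_sqrt_mult)
  moreover have "7 * s^2 + 2 * (1 + sqrt 3) * s + 1 = 4 * s^2 + k^2 + 2 * s"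
    "7 * s^2 + 2 * (2 + sqrt 3) * s + 2 = 4 * s^2 + k^2 + 4 * s + 1"
    unfolding k_def sum_of_squares_expansion by (simp_all add: algebra_simps)
  ultimately show ?thesis unfolding lambda2_def smaller_root_def k_def[symmetric] by presburger
qed

lemma delta2_eq_vertex:
  "delta2 s = (s^2 + 1) / s * vertex s (1 + sqrt 3 * s) (lambda2 s)"
  unfolding delta2_def vertex_def sum_of_squares_expansion by (simp add: algebra_simps)

theorem proposition3:
  fixes s :: real
  assumes "s > 0"
  shows "lambda2 s \<in> {l. l > 0 \<and> (\<exists>\<delta>>0. Qtilde_nonneg s \<delta> l)}
    \<and> (\<forall>l \<in> {l. l > 0 \<and> (\<exists>\<delta>>0. Qtilde_nonneg s \<delta> l)}. l \<le> lambda2 s)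
    \<and> {\<delta>. \<delta> > 0 \<and> Qtilde_nonneg s \<delta> (lambda2 s)} = {delta2 s}"
proof -
  define k where "k = 1 + sqrt 3 * s"
  have k: "k \<ge> 1" using assms by (simp add: k_def)
  have lambda2: "lambda2 s = smaller_root s k"
    using lambda2_eq_smaller_root assms by (simp add: k_def)
  have s2: "1 + s^2 > 0" by (simp add: add_pos_nonneg)
  have iff: "Qtilde_nonneg s \<delta> (lambda2 s) \<longleftrightarrow> \<delta> = delta2 s" for \<delta>
  proof -
    have "Qtilde_nonneg s \<delta> (lambda2 s) \<longleftrightarrow> \<delta> * s / (1 + s^2) = vertex s k (lambda2 s)"
      unfolding Qtilde_nonneg_iff_admissible k_def[symmetric] lambda2
      by (rule admissible_smaller_root_iff[OF assms k])
    also have "\<dots> \<longleftrightarrow> \<delta> = delta2 s"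
      using assms s2 unfolding delta2_eq_vertex k_def[symmetric] by (auto simp: field_simps)
    finally show ?thesis .
  qed
  have "vertex s k (lambda2 s) > 0" using vertex_smaller_root_pos assms k by (simp add: lambda2)
  then have delta2: "delta2 s > 0"
    using assms s2 by (simp add: delta2_eq_vertex k_def[symmetric] add.commute)
  have "l \<le> lambda2 s" if "l > 0" "\<delta> > 0" "Qtilde_nonneg s \<delta> l" for l \<delta>
  proof -
    have "\<delta> * s / (1 + s^2) > 0" using assms s2 that by simp
    then show ?thesis
      using admissible_le_smaller_root[OF assms k] that
      by (simp add: Qtilde_nonneg_iff_admissible lambda2 k_def[symmetric])
  qed
  moreover have "lambda2 s > 0" using smaller_root_bounds(1)[OF assms k] by (simp add: lambda2)
  ultimately show ?thesis using iff delta2 by auto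
qed

end
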